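(* If a monoid variety that is not completely regular is almost $fi$-permutable, then it is $fi$-permutable.
   Context: Monoids are considered as semigroups with an additional 0-ary operation fixing the identity element; varieties are varieties of such algebras. Congruences $\alpha,\beta$ on an algebra permute if $\alpha\beta=\beta\alpha$ (relational product). A variety $\mathbf V$ is $fi$-permutable if every two fully invariant congruences on any $\mathbf V$-free object permute. The least semilattice congruence on a monoid $S$ is the least congruence $\sigma$ such that $S/\sigma$ is commutative and idempotent. A monoid variety $\mathbf V$ is almost $fi$-permutable if, on any $\mathbf V$-free object $F$, every two fully invariant congruences contained in the least semilattice congruence on $F$ permute. A variety is completely regular if it consists of completely regular monoids (unions of groups). *)

theory Defs
  imports "HOL-Algebra.Group"
begin

section \<open>Monoid varieties\<close>

text \<open>
  Monoids carry the identity element as a 0-ary operation, so homomorphisms must preserve it;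
  \<open>hom\<close> on its own does not enforce this for monoids.
\<close>

definition monoid_hom :: "'a monoid \<Rightarrow> 'b monoid \<Rightarrow> ('a \<Rightarrow> 'b) set" where
  "monoid_hom M N = {h \<in> hom M N. h \<one>\<^bsub>M\<^esub> = \<one>\<^bsub>N\<^esub>}"

text \<open>An identity is a pair of (possibly empty) words over a countably infinite alphabet.\<close>

type_synonym identity = "nat list \<times> nat list"

definition eval_word :: "'a monoid \<Rightarrow> ('x \<Rightarrow> 'a) \<Rightarrow> 'x list \<Rightarrow> 'a" where
  "eval_word M \<theta> w = foldr (\<lambda>x a. \<theta> x \<otimes>\<^bsub>M\<^esub> a) w \<one>\<^bsub>M\<^esub>"

definition satisfies :: "'a monoid \<Rightarrow> identity \<Rightarrow> bool" where
  "satisfies M p \<longleftrightarrow>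
     (\<forall>\<theta>. range \<theta> \<subseteq> carrier M \<longrightarrow> eval_word M \<theta> (fst p) = eval_word M \<theta> (snd p))"

text \<open>
  A variety is represented by a set \<open>E\<close> of identities defining it;
  \<open>variety E :: 'a monoid set\<close> consists of its members whose elements are of type \<open>'a\<close>.
\<close>

definition variety :: "identity set \<Rightarrow> 'a monoid set" where
  "variety E = {M. monoid M \<and> (\<forall>p\<in>E. satisfies M p)}"

text \<open>
  A monoid is completely regular if it is a union of groups.  The identity element \<open>e\<close> of a
  subgroup need not be the identity element of the monoid.
\<close>

definition completely_regular :: "'a monoid \<Rightarrow> bool" where
  "completely_regular M \<longleftrightarrow>
     (\<forall>a\<in>carrier M. \<exists>G e. a \<in> G \<and> G \<subseteq> carrier M \<and> group (M\<lparr>carrier := G, one := e\<rparr>))"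

definition completely_regular_variety :: "'m itself \<Rightarrow> identity set \<Rightarrow> bool" where
  "completely_regular_variety _ E \<longleftrightarrow> (\<forall>M :: 'm monoid. M \<in> variety E \<longrightarrow> completely_regular M)"

section \<open>Free objects\<close>

text \<open>
  \<open>free_object E X F\<close>: the monoid \<open>F\<close> is free over the subset \<open>X\<close> in the variety defined by \<open>E\<close>.
  The universal property is tested on members of the variety with elements of type
  \<open>'f list set\<close>.  This loses nothing: for a map from \<open>X\<close> into a member \<open>N\<close> of the
  variety, over whatever type, the submonoid of \<open>N\<close> generated by the image of \<open>X\<close> is a
  quotient of the free monoid of words over \<open>X\<close>, hence has a copy whose elements are sets of words
  over \<open>'f\<close>, and \<open>F\<close> itself has a copy on singletons.
\<close>

definition free_object :: "identity set \<Rightarrow> 'f set \<Rightarrow> 'f monoid \<Rightarrow> bool" where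
  "free_object E X F \<longleftrightarrow>
     F \<in> variety E \<and> X \<subseteq> carrier F \<and>
     (\<forall>M :: 'f list set monoid. M \<in> variety E \<longrightarrow>
        (\<forall>g \<in> X \<rightarrow> carrier M.
           \<exists>!h. h \<in> monoid_hom F M \<inter> extensional (carrier F) \<and> (\<forall>x\<in>X. h x = g x)))"

section \<open>Congruences\<close>

definition congruence :: "'a monoid \<Rightarrow> ('a \<times> 'a) set \<Rightarrow> bool" where
  "congruence M r \<longleftrightarrow> equiv (carrier M) r \<and>
     (\<forall>(a, b)\<in>r. \<forall>(c, d)\<in>r. (a \<otimes>\<^bsub>M\<^esub> c, b \<otimes>\<^bsub>M\<^esub> d) \<in> r)"

definition fully_invariant :: "'a monoid \<Rightarrow> ('a \<times> 'a) set \<Rightarrow> bool" where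
  "fully_invariant M r \<longleftrightarrow> (\<forall>h \<in> monoid_hom M M. \<forall>(a, b)\<in>r. (h a, h b) \<in> r)"

definition quotient_monoid :: "'a monoid \<Rightarrow> ('a \<times> 'a) set \<Rightarrow> 'a set monoid" where
  "quotient_monoid M r =
     \<lparr>carrier = carrier M // r,
      mult = (\<lambda>A B. \<Union>a\<in>A. \<Union>b\<in>B. r `` {a \<otimes>\<^bsub>M\<^esub> b}),
      one = r `` {\<one>\<^bsub>M\<^esub>}\<rparr>"

definition semilattice_congruence :: "'a monoid \<Rightarrow> ('a \<times> 'a) set \<Rightarrow> bool" where
  "semilattice_congruence M r \<longleftrightarrow> congruence M r \<and>
     comm_monoid (quotient_monoid M r) \<and>
     (\<forall>A \<in> carrier (quotient_monoid M r). A \<otimes>\<^bsub>quotient_monoid M r\<^esub> A = A)"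

text \<open>
  The family intersected here contains the universal congruence and is closed under intersection,
  so the intersection is the least semilattice congruence whenever \<open>M\<close> is a monoid.
\<close>

definition least_semilattice_congruence :: "'a monoid \<Rightarrow> ('a \<times> 'a) set" where
  "least_semilattice_congruence M = \<Inter> {r. semilattice_congruence M r}"

definition permute :: "('a \<times> 'a) set \<Rightarrow> ('a \<times> 'a) set \<Rightarrow> bool" where
  "permute \<alpha> \<beta> \<longleftrightarrow> \<alpha> O \<beta> = \<beta> O \<alpha>"

text \<open>
  The type argument is the type of the elements of the free objects considered.
\<close>

definition fi_permutable :: "'f itself \<Rightarrow> identity set \<Rightarrow> bool" where
  "fi_permutable _ E \<longleftrightarrow>
     (\<forall>(F :: 'f monoid) X \<alpha> \<beta>. free_object E X F \<longrightarrow>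
        congruence F \<alpha> \<and> fully_invariant F \<alpha> \<longrightarrow>
        congruence F \<beta> \<and> fully_invariant F \<beta> \<longrightarrow>
        permute \<alpha> \<beta>)"

definition almost_fi_permutable :: "'f itself \<Rightarrow> identity set \<Rightarrow> bool" where
  "almost_fi_permutable _ E \<longleftrightarrow>
     (\<forall>(F :: 'f monoid) X \<alpha> \<beta>. free_object E X F \<longrightarrow>
        congruence F \<alpha> \<and> fully_invariant F \<alpha> \<and> \<alpha> \<subseteq> least_semilattice_congruence F \<longrightarrow>
        congruence F \<beta> \<and> fully_invariant F \<beta> \<and> \<beta> \<subseteq> least_semilattice_congruence F \<longrightarrow>
        permute \<alpha> \<beta>)"

end

theory Submission
  imports Defs
begin

text \<open>
  A fully invariant congruence \<open>\<alpha>\<close> on a free object that is not contained in the least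
  semilattice congruence \<open>\<sigma>\<close> identifies \<open>1\<close> with some \<open>y ^ n\<close>, where \<open>y\<close> is a free generator
  and \<open>n \<ge> 1\<close>.
  Since the variety is not completely regular, it contains the monoid \<open>{1, a, 0}\<close> with \<open>a\<^sup>2 = 0\<close>;
  let \<open>\<gamma>\<close> be the congruence given by its identities and let \<open>\<beta>\<close> be the part of \<open>\<alpha>\<close> that
  preserves the content of words.  Both lie in \<open>\<sigma>\<close>, and \<open>y \<beta> y ^ (n + 1) \<gamma> y\<^sup>2\<close>.  The \<open>\<gamma>\<close>-class of
  \<open>y\<close> is a singleton, so permutability forces \<open>y \<beta> y\<^sup>2\<close>, whence \<open>1 \<alpha> y\<close> and \<open>\<alpha>\<close> is universal.
  A universal congruence permutes with every congruence.
\<close>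

section \<open>Homomorphisms and varieties\<close>

lemma monoid_homI:
  assumes "\<And>a. a \<in> carrier M \<Longrightarrow> h a \<in> carrier N"
    and "\<And>a b. a \<in> carrier M \<Longrightarrow> b \<in> carrier M \<Longrightarrow> h (a \<otimes>\<^bsub>M\<^esub> b) = h a \<otimes>\<^bsub>N\<^esub> h b"
    and "h \<one>\<^bsub>M\<^esub> = \<one>\<^bsub>N\<^esub>"
  shows "h \<in> monoid_hom M N"
  using assms by (auto simp: monoid_hom_def hom_def)

lemma
  assumes "h \<in> monoid_hom M N"
  shows monoid_hom_closed: "a \<in> carrier M \<Longrightarrow> h a \<in> carrier N"
    and monoid_hom_mult: "a \<in> carrier M \<Longrightarrow> b \<in> carrier M \<Longrightarrow> h (a \<otimes>\<^bsub>M\<^esub> b) = h a \<otimes>\<^bsub>N\<^esub> h b"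
    and monoid_hom_one: "h \<one>\<^bsub>M\<^esub> = \<one>\<^bsub>N\<^esub>"
  using assms by (auto simp: monoid_hom_def hom_def)

lemma monoid_hom_comp:
  "\<lbrakk>h \<in> monoid_hom M N; k \<in> monoid_hom N P\<rbrakk> \<Longrightarrow> (\<lambda>a. k (h a)) \<in> monoid_hom M P"
  by (intro monoid_homI) (simp_all add: monoid_hom_closed monoid_hom_mult monoid_hom_one)

lemma monoid_hom_pow:
  assumes "monoid M" "h \<in> monoid_hom M N" "a \<in> carrier M"
  shows "h (a [^]\<^bsub>M\<^esub> (n::nat)) = h a [^]\<^bsub>N\<^esub> n"
  using assms
  by (induction n) (auto simp: nat_pow_def monoid_hom_one monoid_hom_mult
      monoid.nat_pow_closed[unfolded nat_pow_def])

section \<open>Evaluation of words\<close>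

lemma eval_word_simps [simp]:
  "eval_word M \<theta> [] = \<one>\<^bsub>M\<^esub>"
  "eval_word M \<theta> (x # w) = \<theta> x \<otimes>\<^bsub>M\<^esub> eval_word M \<theta> w"
  by (simp_all add: eval_word_def)

lemma eval_word_closed:
  assumes "monoid M" "\<theta> ` set w \<subseteq> carrier M"
  shows "eval_word M \<theta> w \<in> carrier M"
  using assms(2) by (induction w) (auto simp: monoid.m_closed[OF assms(1)] monoid.one_closed[OF assms(1)])

lemma eval_word_append:
  assumes "monoid M" "\<theta> ` set v \<subseteq> carrier M" "\<theta> ` set w \<subseteq> carrier M"
  shows "eval_word M \<theta> (v @ w) = eval_word M \<theta> v \<otimes>\<^bsub>M\<^esub> eval_word M \<theta> w"
proof -
  interpret monoid M by fact
  show ?thesis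
    using assms(2,3) by (induction v) (auto simp: m_assoc eval_word_closed[OF assms(1)])
qed

lemma monoid_hom_eval_word:
  assumes "monoid M" "h \<in> monoid_hom M N" "\<theta> ` set w \<subseteq> carrier M"
  shows "h (eval_word M \<theta> w) = eval_word N (\<lambda>x. h (\<theta> x)) w"
  using assms(3)
  by (induction w) (auto simp: monoid_hom_one[OF assms(2)] monoid_hom_mult[OF assms(2)]
      eval_word_closed[OF assms(1)])

text \<open>Substituting powers of a single element turns an identity of words into an equality of
  exponents; this is how identities are compared with truncated addition later.\<close>

lemma eval_word_pow:
  assumes "monoid M" "a \<in> carrier M"
  shows "eval_word M (\<lambda>x. a [^]\<^bsub>M\<^esub> (\<theta> x :: nat)) w = a [^]\<^bsub>M\<^esub> sum_list (map \<theta> w)"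
proof -
  interpret monoid M by fact
  show ?thesis
    by (induction w) (auto simp: nat_pow_mult assms(2))
qed

lemma satisfiesD:
  "\<lbrakk>satisfies M p; range \<theta> \<subseteq> carrier M\<rbrakk> \<Longrightarrow> eval_word M \<theta> (fst p) = eval_word M \<theta> (snd p)"
  by (simp add: satisfies_def)

text \<open>An injective homomorphism reflects equality of evaluated words, so identities pass down.
  This covers both submonoids and isomorphic copies.\<close>

lemma variety_embed:
  assumes "M \<in> variety E" "monoid N" "h \<in> monoid_hom N M" "inj_on h (carrier N)"
  shows "N \<in> variety E"
proof -
  have "satisfies N p" if "p \<in> E" for p
    unfolding satisfies_def
  proof (intro allI impI)
    fix \<theta> :: "nat \<Rightarrow> _" assume \<theta>: "range \<theta> \<subseteq> carrier N"
    have eval: "h (eval_word N \<theta> w) = eval_word M (\<lambda>x. h (\<theta> x)) w" for w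
      using \<theta> by (intro monoid_hom_eval_word assms) auto
    have "range (\<lambda>x. h (\<theta> x)) \<subseteq> carrier M"
      using \<theta> monoid_hom_closed[OF assms(3)] by auto
    hence "h (eval_word N \<theta> (fst p)) = h (eval_word N \<theta> (snd p))"
      using assms(1) that unfolding eval variety_def satisfies_def by blast
    moreover have "eval_word N \<theta> w \<in> carrier N" for w
      using \<theta> by (intro eval_word_closed assms) auto
    ultimately show "eval_word N \<theta> (fst p) = eval_word N \<theta> (snd p)"
      using assms(4) by (meson inj_onD)
  qed
  with assms(2) show ?thesis by (simp add: variety_def)
qed

text \<open>The universal property of a free object quantifies over monoids on one fixed type only.
  Transport of structure along \<phi> moves any other member of the variety to that type.\<close>

lemma variety_isomorphic_copy:
  assumes "N \<in> variety E" "inj_on \<phi> (carrier N)"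
  obtains N' where "N' \<in> variety E" "\<phi> \<in> monoid_hom N N'" "inv_into (carrier N) \<phi> \<in> monoid_hom N' N"
proof -
  interpret monoid N using assms(1) by (simp add: variety_def)
  define \<psi> where "\<psi> = inv_into (carrier N) \<phi>"
  define N' where "N' = \<lparr>carrier = \<phi> ` carrier N, mult = (\<lambda>a b. \<phi> (\<psi> a \<otimes>\<^bsub>N\<^esub> \<psi> b)), one = \<phi> \<one>\<^bsub>N\<^esub>\<rparr>"
  have \<psi>: "\<psi> (\<phi> a) = a" if "a \<in> carrier N" for a
    using that assms(2) by (simp add: \<psi>_def)
  have "monoid N'"
    by (rule monoidI) (auto simp: N'_def \<psi> m_assoc)
  moreover have "\<psi> \<in> monoid_hom N' N"
    by (rule monoid_homI) (auto simp: N'_def \<psi>)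
  moreover have "inj_on \<psi> (carrier N')"
    by (auto simp: N'_def inj_on_def \<psi>)
  ultimately have "N' \<in> variety E"
    using variety_embed[OF assms(1)] by blast
  moreover have "\<phi> \<in> monoid_hom N N'"
    by (rule monoid_homI) (auto simp: N'_def \<psi>)
  ultimately show ?thesis
    using that[of N'] \<open>\<psi> \<in> monoid_hom N' N\<close> by (simp add: \<psi>_def)
qed

section \<open>Free objects\<close>

lemma
  assumes "free_object E X F"
  shows free_object_in_variety: "F \<in> variety E"
    and free_object_monoid: "monoid F"
    and free_object_generators: "X \<subseteq> carrier F"
  using assms by (auto simp: free_object_def variety_def)

lemma free_object_universal:
  fixes F :: "'f monoid" and M :: "'f list set monoid"
  assumes "free_object E X F" "M \<in> variety E" "g \<in> X \<rightarrow> carrier M"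
  shows "\<exists>!h. h \<in> monoid_hom F M \<inter> extensional (carrier F) \<and> (\<forall>x\<in>X. h x = g x)"
proof -
  have "\<forall>M :: 'f list set monoid. M \<in> variety E \<longrightarrow> (\<forall>g \<in> X \<rightarrow> carrier M.
      \<exists>!h. h \<in> monoid_hom F M \<inter> extensional (carrier F) \<and> (\<forall>x\<in>X. h x = g x))"
    using assms(1) unfolding free_object_def by (elim conjE)
  from this[rule_format, OF assms(2,3)] show ?thesis .
qed

text \<open>Existence half of the universal property, freed from the fixed target type: extend into
  the copy of \<open>N\<close>, then return along the inverse of \<phi>.\<close>

lemma free_object_extend:
  fixes F :: "'f monoid" and \<phi> :: "'n \<Rightarrow> 'f list set"
  assumes "free_object E X F" "N \<in> variety E" "inj_on \<phi> (carrier N)" "g \<in> X \<rightarrow> carrier N"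
  obtains h where "h \<in> monoid_hom F N" "\<forall>x\<in>X. h x = g x"
proof -
  obtain N' where N': "N' \<in> variety E" "\<phi> \<in> monoid_hom N N'" "inv_into (carrier N) \<phi> \<in> monoid_hom N' N"
    by (rule variety_isomorphic_copy[OF assms(2,3)])
  have "(\<lambda>x. \<phi> (g x)) \<in> X \<rightarrow> carrier N'"
    using assms(4) monoid_hom_closed[OF N'(2)] by (auto simp: Pi_iff)
  from ex1_implies_ex[OF free_object_universal[OF assms(1) N'(1) this]]
  obtain h where h: "h \<in> monoid_hom F N'" "\<forall>x\<in>X. h x = \<phi> (g x)"
    by (elim exE conjE IntE)
  show ?thesis
  proof (rule that[OF monoid_hom_comp[OF h(1) N'(3)]])
    show "\<forall>x\<in>X. inv_into (carrier N) \<phi> (h x) = g x"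
      using h(2) assms(3,4) by (simp add: Pi_iff)
  qed
qed

lemma free_object_hom_unique:
  fixes F :: "'f monoid" and \<phi> :: "'n \<Rightarrow> 'f list set"
  assumes "free_object E X F" "N \<in> variety E" "inj_on \<phi> (carrier N)"
    and "h \<in> monoid_hom F N" "k \<in> monoid_hom F N" "\<And>x. x \<in> X \<Longrightarrow> h x = k x" "a \<in> carrier F"
  shows "h a = k a"
proof -
  obtain N' where N': "N' \<in> variety E" "\<phi> \<in> monoid_hom N N'"
    by (rule variety_isomorphic_copy[OF assms(2,3)])
  interpret monoid F using free_object_monoid[OF assms(1)] .
  \<comment> \<open>Uniqueness is available only among extensional maps into the copy, so each
    homomorphism is composed with \<phi> and restricted to the carrier of \<open>F\<close>.\<close>
  define R where "R = (\<lambda>f. restrict (\<lambda>a. \<phi> (f a)) (carrier F))"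
  have R: "R f \<in> monoid_hom F N' \<inter> extensional (carrier F)" if "f \<in> monoid_hom F N" for f
  proof -
    have "R f \<in> monoid_hom F N'"
      using monoid_hom_closed[OF that] that N'(2)
      by (intro monoid_homI) (simp_all add: R_def monoid_hom_closed monoid_hom_mult monoid_hom_one)
    thus ?thesis by (simp add: R_def)
  qed
  have X: "x \<in> carrier F" if "x \<in> X" for x
    using that free_object_generators[OF assms(1)] by auto
  have "(\<lambda>x. \<phi> (k x)) \<in> X \<rightarrow> carrier N'"
    using X monoid_hom_closed[OF monoid_hom_comp[OF assms(5) N'(2)]] by (simp add: Pi_iff)
  note ex1 = free_object_universal[OF assms(1) N'(1) this]
  have "\<forall>x\<in>X. R h x = \<phi> (k x)" "\<forall>x\<in>X. R k x = \<phi> (k x)"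
    using X assms(6) by (auto simp: R_def)
  hence "R h = R k"
    using ex1[unfolded Ex1_def] R[OF assms(4)] R[OF assms(5)] by blast
  hence "R h a = R k a" by simp
  hence "\<phi> (h a) = \<phi> (k a)" using assms(7) by (simp add: R_def)
  thus ?thesis
    using assms(3) monoid_hom_closed[OF assms(4,7)] monoid_hom_closed[OF assms(5,7)]
    by (meson inj_onD)
qed

text \<open>Retraction argument: the submonoid \<open>G\<close> of values of words over
  \<open>X\<close> lies in the variety, so the inclusion of \<open>X\<close> extends to a
  homomorphism from \<open>F\<close> to \<open>G\<close>. Followed by the inclusion into
  \<open>F\<close> it agrees with the identity on \<open>X\<close>, hence everywhere, and so
  \<open>a\<close> lies in \<open>G\<close>.\<close>

lemma free_object_generated:
  fixes F :: "'f monoid"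
  assumes "free_object E X F" "a \<in> carrier F"
  obtains ws where "set ws \<subseteq> X" "a = eval_word F (\<lambda>x. x) ws"
proof -
  note F = free_object_in_variety[OF assms(1)]
  note X = free_object_generators[OF assms(1)]
  interpret monoid F using free_object_monoid[OF assms(1)] .
  define S where "S = eval_word F (\<lambda>x. x) ` {ws. set ws \<subseteq> X}"
  have S_carrier: "S \<subseteq> carrier F"
    using X by (auto simp: S_def intro!: eval_word_closed monoid_axioms)
  have S_mult: "b \<otimes>\<^bsub>F\<^esub> c \<in> S" if bc: "b \<in> S" "c \<in> S" for b c
  proof -
    obtain v w where "set v \<subseteq> X" "set w \<subseteq> X"
      "b = eval_word F (\<lambda>x. x) v" "c = eval_word F (\<lambda>x. x) w"
      using bc unfolding S_def by blast
    moreover from this have "b \<otimes>\<^bsub>F\<^esub> c = eval_word F (\<lambda>x. x) (v @ w)"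
      using X by (subst eval_word_append[OF monoid_axioms]) auto
    ultimately show ?thesis unfolding S_def by (intro image_eqI[of _ _ "v @ w"]) auto
  qed
  have S_one: "\<one>\<^bsub>F\<^esub> \<in> S"
    unfolding S_def by (rule image_eqI[of _ _ "[]"]) auto
  have S_gen: "X \<subseteq> S"
  proof
    fix x assume "x \<in> X"
    thus "x \<in> S" using X unfolding S_def by (intro image_eqI[of _ _ "[x]"]) auto
  qed
  define G where "G = F\<lparr>carrier := S\<rparr>"
  have "monoid G"
    using S_carrier S_mult S_one by (intro monoidI) (auto simp: G_def m_assoc subset_iff)
  moreover have incl: "(\<lambda>b. b) \<in> monoid_hom G F"
    using S_carrier by (intro monoid_homI) (auto simp: G_def)
  ultimately have G: "G \<in> variety E"
    using variety_embed[OF F _ incl] by (simp add: inj_on_def)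
  \<comment> \<open>Singletons of one-letter words embed the type of \<open>F\<close> into the type
    on which the universal property is tested.\<close>
  have inj: "inj_on (\<lambda>b::'f. {[b]}) A" for A
    by (simp add: inj_on_def)
  have "(\<lambda>x. x) \<in> X \<rightarrow> carrier G"
    using S_gen by (auto simp: G_def)
  then obtain h where h: "h \<in> monoid_hom F G" "\<forall>x\<in>X. h x = x"
    by (rule free_object_extend[OF assms(1) G inj])
  have "(\<lambda>b. b) \<in> monoid_hom F F" by (intro monoid_homI) auto
  hence "h a = a"
    using free_object_hom_unique[OF assms(1) F inj monoid_hom_comp[OF h(1) incl] _ _ assms(2)] h(2)
    by simp
  moreover have "h a \<in> S" using monoid_hom_closed[OF h(1) assms(2)] by (simp add: G_def)
  ultimately show ?thesis using that unfolding S_def by auto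
qed

text \<open>Sending every generator other than \<open>y\<close> to the identity element erases all
  other letters. The lemma serves both for truncated addition and for endomorphisms of
  \<open>F\<close>.\<close>

lemma free_object_count_hom:
  fixes F :: "'f monoid" and \<phi> :: "'n \<Rightarrow> 'f list set"
  assumes "free_object E X F" "N \<in> variety E" "inj_on \<phi> (carrier N)" "y \<in> X" "c \<in> carrier N"
  obtains h where "h \<in> monoid_hom F N" "h y = c"
    "\<forall>ws. set ws \<subseteq> X \<longrightarrow> h (eval_word F (\<lambda>x. x) ws) = c [^]\<^bsub>N\<^esub> count_list ws y"
proof -
  interpret monoid N using assms(2) by (simp add: variety_def)
  have "(\<lambda>x. if x = y then c else \<one>\<^bsub>N\<^esub>) \<in> X \<rightarrow> carrier N"
    using assms(5) by auto
  then obtain h where h: "h \<in> monoid_hom F N" "\<forall>x\<in>X. h x = (if x = y then c else \<one>\<^bsub>N\<^esub>)"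
    by (rule free_object_extend[OF assms(1-3)])
  show ?thesis
  proof (rule that[OF h(1)])
    show "h y = c" using h(2) assms(4) by simp
    \<comment> \<open>Words are evaluated by multiplying on the left, whereas powers grow on the
      right.\<close>
    have pow_comm: "c \<otimes>\<^bsub>N\<^esub> c [^]\<^bsub>N\<^esub> m = c [^]\<^bsub>N\<^esub> m \<otimes>\<^bsub>N\<^esub> c" for m :: nat
      using nat_pow_Suc2[OF assms(5), of m] by simp
    show "\<forall>ws. set ws \<subseteq> X \<longrightarrow> h (eval_word F (\<lambda>x. x) ws) = c [^]\<^bsub>N\<^esub> count_list ws y"
    proof (intro allI impI)
      fix ws assume ws: "set ws \<subseteq> X"
      have "h (eval_word F (\<lambda>x. x) ws) = eval_word N h ws"
        using monoid_hom_eval_word[OF free_object_monoid[OF assms(1)] h(1), of "\<lambda>x. x"] ws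
          free_object_generators[OF assms(1)] by auto
      also have "\<dots> = c [^]\<^bsub>N\<^esub> count_list ws y"
        using ws by (induction ws) (auto simp: h(2) assms(5) pow_comm)
      finally show "h (eval_word F (\<lambda>x. x) ws) = c [^]\<^bsub>N\<^esub> count_list ws y" .
    qed
  qed
qed

section \<open>Truncated addition and completely regular varieties\<close>

text \<open>For \<open>k = 1\<close> this is the two-element semilattice, for \<open>k = 2\<close> the monoid \<open>{1, a, 0}\<close> with \<open>a\<^sup>2 = 0\<close>.\<close>

definition truncated_addition :: "nat \<Rightarrow> nat monoid" where
  "truncated_addition k = \<lparr>carrier = {..k}, mult = (\<lambda>a b. min k (a + b)), one = 0\<rparr>"

lemma truncated_addition_simps [simp]:
  "carrier (truncated_addition k) = {..k}"
  "a \<otimes>\<^bsub>truncated_addition k\<^esub> b = min k (a + b)"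
  "\<one>\<^bsub>truncated_addition k\<^esub> = 0"
  by (simp_all add: truncated_addition_def)

lemma monoid_truncated_addition: "monoid (truncated_addition k)"
  by (rule monoidI) auto

lemma truncated_addition_pow: "a [^]\<^bsub>truncated_addition k\<^esub> (n::nat) = min k (n * a)"
  by (induction n) (auto simp: nat_pow_def)

lemma eval_word_truncated_addition:
  "eval_word (truncated_addition k) \<theta> w = min k (sum_list (map \<theta> w))"
  by (induction w) auto

text \<open>The equation \<open>a [^] (Suc d) = a\<close> makes the positive powers periodic with
  period \<open>d\<close>, so \<open>a [^] d\<close> is neutral among them, although it may differ
  from the identity element of the monoid.\<close>

lemma (in monoid) group_of_positive_powers:
  assumes "a \<in> carrier G" "a [^] (Suc d) = a" "d > 0"
  shows "group (G\<lparr>carrier := (\<lambda>k::nat. a [^] k) ` {1..}, one := a [^] d\<rparr>)" (is "group ?H")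
proof -
  have absorb: "a [^] (k + d) = a [^] k" if "k \<ge> 1" for k
  proof -
    obtain j where k: "k = Suc j" using \<open>k \<ge> 1\<close> by (cases k) auto
    have "a [^] (k + d) = a [^] j \<otimes> a [^] Suc d"
      using assms(1) k by (metis nat_pow_mult add_Suc add_Suc_right)
    also have "\<dots> = a [^] k" using assms(2) k by simp
    finally show ?thesis .
  qed
  have absorb_mult: "a [^] (d + m * d) = a [^] d" for m
  proof (induction m)
    case (Suc m)
    have "a [^] (d + Suc m * d) = a [^] ((d + m * d) + d)" by (simp add: algebra_simps)
    also have "\<dots> = a [^] d" using Suc absorb[of "d + m * d"] assms(3) by simp
    finally show ?case .
  qed simp
  show ?thesis
  proof (rule groupI)
    fix b assume "b \<in> carrier ?H"
    then obtain k where k: "k \<ge> 1" "b = a [^] (k::nat)" by fastforce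
    \<comment> \<open>The inverse of \<open>a [^] k\<close> is
      \<open>a [^] (k * (d - 1) + d)\<close>; the summand \<open>d\<close> keeps the exponent
      positive even when \<open>d = 1\<close>.\<close>
    have "(k * (d - 1) + d) + k = d + k * d"
      using assms(3) by (cases d) (auto simp: algebra_simps)
    hence "a [^] (k * (d - 1) + d) \<otimes> b = a [^] d"
      using absorb_mult[of k] assms(1) k(2) by (simp only: nat_pow_mult)
    moreover have "k * (d - 1) + d \<in> {1..}" using assms(3) by simp
    ultimately show "\<exists>c\<in>carrier ?H. c \<otimes>\<^bsub>?H\<^esub> b = \<one>\<^bsub>?H\<^esub>" by auto
  qed (use assms absorb in \<open>auto simp: nat_pow_mult m_assoc add.commute add.left_commute intro!: imageI\<close>)
qed

text \<open>Take an element \<open>a\<close> of a member of the variety that lies in no subgroup. A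
  coincidence between two different powers of \<open>a\<close> can involve only exponents at least
  2, so the powers of \<open>a\<close> separate everything that truncated addition with
  \<open>k \<le> 2\<close> separates.\<close>

lemma truncated_addition_in_variety:
  assumes "\<not> completely_regular_variety TYPE('m) E" "k \<le> 2"
  shows "truncated_addition k \<in> variety E"
proof -
  obtain M :: "'m monoid" where M: "M \<in> variety E" "\<not> completely_regular M"
    using assms(1) unfolding completely_regular_variety_def by auto
  interpret monoid M using M(1) by (simp add: variety_def)
  obtain a where a: "a \<in> carrier M"
    and no_subgroup: "\<not> (\<exists>G e. a \<in> G \<and> G \<subseteq> carrier M \<and> group (M\<lparr>carrier := G, one := e\<rparr>))"
    using M(2) unfolding completely_regular_def by (auto simp only: ball_simps(10))
  have no_period: "a [^]\<^bsub>M\<^esub> Suc d \<noteq> a" if "d > 0" for d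
  proof
    assume "a [^]\<^bsub>M\<^esub> Suc d = a"
    note group = group_of_positive_powers[OF a this that]
    have "a \<in> (\<lambda>k::nat. a [^]\<^bsub>M\<^esub> k) ` {1..}"
      using a by (intro image_eqI[of _ _ 1]) simp_all
    moreover have "(\<lambda>k::nat. a [^]\<^bsub>M\<^esub> k) ` {1..} \<subseteq> carrier M"
      using a by auto
    ultimately show False using no_subgroup group by (elim notE) (intro exI conjI)
  qed
  have ge_2: "s \<ge> 2" if eq: "a [^]\<^bsub>M\<^esub> s = a [^]\<^bsub>M\<^esub> t" and "s < t" for s t :: nat
  proof (rule ccontr)
    assume "\<not> s \<ge> 2"
    \<comment> \<open>Truncated subtraction treats \<open>s = 0\<close> and \<open>s = 1\<close>
      together: the factor lifts the smaller exponent to exactly 1.\<close>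
    have "a [^]\<^bsub>M\<^esub> (s + (1 - s)) = a [^]\<^bsub>M\<^esub> (t + (1 - s))"
      using eq a by (simp flip: nat_pow_mult)
    moreover have "s + (1 - s) = 1" "t + (1 - s) = Suc (t - s)"
      using \<open>\<not> s \<ge> 2\<close> \<open>s < t\<close> by linarith+
    ultimately have "a [^]\<^bsub>M\<^esub> Suc (t - s) = a"
      using a by simp
    with no_period[of "t - s"] \<open>s < t\<close> show False by simp
  qed
  have "satisfies (truncated_addition k) p" if "p \<in> E" for p
    unfolding satisfies_def
  proof (intro allI impI)
    fix \<theta> :: "nat \<Rightarrow> nat"
    have "satisfies M p" using M(1) that by (auto simp: variety_def)
    moreover have "range (\<lambda>x. a [^]\<^bsub>M\<^esub> \<theta> x) \<subseteq> carrier M" using a by auto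
    ultimately have "eval_word M (\<lambda>x. a [^]\<^bsub>M\<^esub> \<theta> x) (fst p) = eval_word M (\<lambda>x. a [^]\<^bsub>M\<^esub> \<theta> x) (snd p)"
      by (rule satisfiesD)
    hence eq: "a [^]\<^bsub>M\<^esub> sum_list (map \<theta> (fst p)) = a [^]\<^bsub>M\<^esub> sum_list (map \<theta> (snd p))"
      by (simp only: eval_word_pow[OF monoid_axioms a])
    \<comment> \<open>If the exponents differ, the smaller one is at least 2, and then truncation at
      \<open>k \<le> 2\<close> sends both to \<open>k\<close>.\<close>
    have "sum_list (map \<theta> (fst p)) = sum_list (map \<theta> (snd p)) \<or>
        (sum_list (map \<theta> (fst p)) \<ge> 2 \<and> sum_list (map \<theta> (snd p)) \<ge> 2)"
      using ge_2[OF eq] ge_2[OF eq[symmetric]] by linarith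
    thus "eval_word (truncated_addition k) \<theta> (fst p) = eval_word (truncated_addition k) \<theta> (snd p)"
      using assms(2) by (auto simp: eval_word_truncated_addition)
  qed
  thus ?thesis by (simp add: variety_def monoid_truncated_addition)
qed

text \<open>Coding a number as the length of a word over one letter places truncated addition in the
  test type for every type of elements of \<open>F\<close>, even a finite one.\<close>

lemma inj_replicate_singleton: "inj_on (\<lambda>n. {replicate n a}) A"
  by (auto simp: inj_on_def)

section \<open>Congruences\<close>

lemma
  assumes "congruence M r"
  shows congruence_refl: "a \<in> carrier M \<Longrightarrow> (a, a) \<in> r"
    and congruence_sym: "(a, b) \<in> r \<Longrightarrow> (b, a) \<in> r"
    and congruence_trans: "(a, b) \<in> r \<Longrightarrow> (b, c) \<in> r \<Longrightarrow> (a, c) \<in> r"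
    and congruence_mult: "(a, b) \<in> r \<Longrightarrow> (c, d) \<in> r \<Longrightarrow> (a \<otimes>\<^bsub>M\<^esub> c, b \<otimes>\<^bsub>M\<^esub> d) \<in> r"
    and congruence_carrier: "r \<subseteq> carrier M \<times> carrier M"
proof -
  have r: "equiv (carrier M) r" and
    m: "\<forall>(a, b)\<in>r. \<forall>(c, d)\<in>r. (a \<otimes>\<^bsub>M\<^esub> c, b \<otimes>\<^bsub>M\<^esub> d) \<in> r"
    using assms by (auto simp: congruence_def)
  show "a \<in> carrier M \<Longrightarrow> (a, a) \<in> r" using r by (meson equiv_def refl_onD)
  show "(a, b) \<in> r \<Longrightarrow> (b, a) \<in> r" using r by (meson equiv_def symD)
  show "(a, b) \<in> r \<Longrightarrow> (b, c) \<in> r \<Longrightarrow> (a, c) \<in> r" using r by (meson equiv_def transD)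
  show "(a, b) \<in> r \<Longrightarrow> (c, d) \<in> r \<Longrightarrow> (a \<otimes>\<^bsub>M\<^esub> c, b \<otimes>\<^bsub>M\<^esub> d) \<in> r" using m by blast
  show "r \<subseteq> carrier M \<times> carrier M" using r by (rule equiv_type)
qed

lemma congruenceI:
  assumes "r \<subseteq> carrier M \<times> carrier M"
    and "\<And>a. a \<in> carrier M \<Longrightarrow> (a, a) \<in> r"
    and "\<And>a b. (a, b) \<in> r \<Longrightarrow> (b, a) \<in> r"
    and "\<And>a b c. (a, b) \<in> r \<Longrightarrow> (b, c) \<in> r \<Longrightarrow> (a, c) \<in> r"
    and "\<And>a b c d. (a, b) \<in> r \<Longrightarrow> (c, d) \<in> r \<Longrightarrow> (a \<otimes>\<^bsub>M\<^esub> c, b \<otimes>\<^bsub>M\<^esub> d) \<in> r"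
  shows "congruence M r"
  unfolding congruence_def
  by (intro conjI equivI refl_onI symI transI) (use assms in blast)+

lemma congruence_Int:
  assumes "congruence M r" "congruence M s"
  shows "congruence M (r \<inter> s)"
  using congruence_carrier[OF assms(1)]
  by (intro congruenceI)
     (auto intro: congruence_refl congruence_sym congruence_trans congruence_mult assms)

section \<open>Full invariance and kernels\<close>

lemma fully_invariantD:
  "\<lbrakk>fully_invariant M r; h \<in> monoid_hom M M; (a, b) \<in> r\<rbrakk> \<Longrightarrow> (h a, h b) \<in> r"
  unfolding fully_invariant_def by blast

lemma fully_invariant_Int:
  "\<lbrakk>fully_invariant M r; fully_invariant M s\<rbrakk> \<Longrightarrow> fully_invariant M (r \<inter> s)"
  unfolding fully_invariant_def by blast

lemma permute_universal:
  assumes "congruence M r"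
  shows "permute (carrier M \<times> carrier M) r" "permute r (carrier M \<times> carrier M)"
  using congruence_refl[OF assms] congruence_carrier[OF assms] unfolding permute_def by blast+

text \<open>If \<open>M\<close> is free in a variety containing \<open>N\<close>, this is the
  congruence given by the identities of \<open>N\<close>. Using all homomorphisms, not just one, is
  what makes it fully invariant.\<close>

definition hom_kernel :: "'a monoid \<Rightarrow> 'b monoid \<Rightarrow> ('a \<times> 'a) set" where
  "hom_kernel M N = {(a, b). a \<in> carrier M \<and> b \<in> carrier M \<and> (\<forall>h \<in> monoid_hom M N. h a = h b)}"

lemma congruence_hom_kernel:
  assumes "monoid M"
  shows "congruence M (hom_kernel M N)"
proof (rule congruenceI)
  show "(a \<otimes>\<^bsub>M\<^esub> c, b \<otimes>\<^bsub>M\<^esub> d) \<in> hom_kernel M N"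
    if "(a, b) \<in> hom_kernel M N" "(c, d) \<in> hom_kernel M N" for a b c d
    using that monoid.m_closed[OF assms] unfolding hom_kernel_def
    by (clarsimp simp: monoid_hom_mult) metis
qed (auto simp: hom_kernel_def)

lemma fully_invariant_hom_kernel: "fully_invariant M (hom_kernel M N)"
  by (auto simp: fully_invariant_def hom_kernel_def monoid_hom_closed dest: monoid_hom_comp)

section \<open>The least semilattice congruence and the content of words\<close>

lemma quotient_monoid_mult:
  assumes "congruence M r" "a \<in> carrier M" "b \<in> carrier M"
  shows "(r `` {a}) \<otimes>\<^bsub>quotient_monoid M r\<^esub> (r `` {b}) = r `` {a \<otimes>\<^bsub>M\<^esub> b}"
proof -
  have r: "equiv (carrier M) r" using assms(1) by (simp add: congruence_def)
  have "r `` {a' \<otimes>\<^bsub>M\<^esub> b'} = r `` {a \<otimes>\<^bsub>M\<^esub> b}" if "a' \<in> r `` {a}" "b' \<in> r `` {b}" for a' b'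
    using that by (intro equiv_class_eq[OF r, symmetric] congruence_mult[OF assms(1)]) simp_all
  moreover have "a \<in> r `` {a}" "b \<in> r `` {b}"
    using equiv_class_self[OF r] assms(2,3) by simp_all
  ultimately have "(\<Union>a'\<in>r `` {a}. \<Union>b'\<in>r `` {b}. r `` {a' \<otimes>\<^bsub>M\<^esub> b'}) = r `` {a \<otimes>\<^bsub>M\<^esub> b}"
    by blast
  thus ?thesis by (simp add: quotient_monoid_def)
qed

lemma
  assumes "monoid M" "semilattice_congruence M r"
  shows semilattice_congruence_commute:
      "\<lbrakk>a \<in> carrier M; b \<in> carrier M\<rbrakk> \<Longrightarrow> (a \<otimes>\<^bsub>M\<^esub> b, b \<otimes>\<^bsub>M\<^esub> a) \<in> r"
    and semilattice_congruence_idem: "a \<in> carrier M \<Longrightarrow> (a \<otimes>\<^bsub>M\<^esub> a, a) \<in> r"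
proof -
  interpret monoid M by fact
  let ?Q = "quotient_monoid M r"
  have r: "congruence M r" "comm_monoid ?Q" "\<And>A. A \<in> carrier ?Q \<Longrightarrow> A \<otimes>\<^bsub>?Q\<^esub> A = A"
    using assms(2) by (auto simp: semilattice_congruence_def)
  have cl: "r `` {a} \<in> carrier ?Q" if "a \<in> carrier M" for a
    using that by (simp add: quotient_monoid_def quotientI)
  have eq: "(a, b) \<in> r" if "r `` {a} = r `` {b}" "b \<in> carrier M" for a b
    using eq_equiv_class[OF that(1) _ that(2)] r(1) by (simp add: congruence_def)
  show "(a \<otimes>\<^bsub>M\<^esub> b, b \<otimes>\<^bsub>M\<^esub> a) \<in> r" if "a \<in> carrier M" "b \<in> carrier M"
    using comm_monoid.m_comm[OF r(2) cl cl] that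
    by (intro eq) (simp_all add: quotient_monoid_mult[OF r(1)])
  show "(a \<otimes>\<^bsub>M\<^esub> a, a) \<in> r" if "a \<in> carrier M"
    using r(3)[OF cl] that by (intro eq) (simp_all add: quotient_monoid_mult[OF r(1)])
qed

text \<open>Modulo commutativity and idempotence, a word absorbs every word whose letters it
  contains. Hence \<open>v\<close> is related to \<open>w @ v\<close>, then to \<open>v @ w\<close>,
  then to \<open>w\<close>.\<close>

lemma same_content_least_semilattice_congruence:
  assumes "monoid M" "\<theta> ` set v \<subseteq> carrier M" "set v = set w"
  shows "(eval_word M \<theta> v, eval_word M \<theta> w) \<in> least_semilattice_congruence M"
  unfolding least_semilattice_congruence_def
proof (rule InterI, clarify)
  fix r assume sl: "semilattice_congruence M r"
  interpret monoid M by fact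
  let ?e = "eval_word M \<theta>"
  have r: "congruence M r" using sl by (simp add: semilattice_congruence_def)
  note refl = congruence_refl[OF r] and sym = congruence_sym[OF r]
    and trans = congruence_trans[OF r] and mult = congruence_mult[OF r]
    and idem = semilattice_congruence_idem[OF assms(1) sl]
    and comm = semilattice_congruence_commute[OF assms(1) sl]
    and cl = eval_word_closed[OF assms(1)]
  have absorb_letter: "(\<theta> x \<otimes>\<^bsub>M\<^esub> ?e w, ?e w) \<in> r" if "x \<in> set w" "\<theta> ` set w \<subseteq> carrier M" for x w
    using that
  proof (induction w)
    case (Cons y w)
    hence c: "\<theta> x \<in> carrier M" "\<theta> y \<in> carrier M" "?e w \<in> carrier M" by (auto intro: cl)
    show ?case
    proof (cases "x = y")
      case True
      thus ?thesis using mult[OF idem[OF c(2)] refl[OF c(3)]] c by (simp add: m_assoc)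
    next
      case False
      \<comment> \<open>The letter \<open>x\<close> moves to the right until it meets an occurrence
        of itself.\<close>
      have "(\<theta> x \<otimes>\<^bsub>M\<^esub> (\<theta> y \<otimes>\<^bsub>M\<^esub> ?e w), \<theta> y \<otimes>\<^bsub>M\<^esub> (\<theta> x \<otimes>\<^bsub>M\<^esub> ?e w)) \<in> r"
        using mult[OF comm[OF c(1,2)] refl[OF c(3)]] c by (simp add: m_assoc)
      moreover have "(\<theta> y \<otimes>\<^bsub>M\<^esub> (\<theta> x \<otimes>\<^bsub>M\<^esub> ?e w), \<theta> y \<otimes>\<^bsub>M\<^esub> ?e w) \<in> r"
        using Cons False by (intro mult refl c) auto
      ultimately show ?thesis using trans by simp
    qed
  qed simp
  have absorb: "(?e u \<otimes>\<^bsub>M\<^esub> ?e w, ?e w) \<in> r" if "set u \<subseteq> set w" "\<theta> ` set w \<subseteq> carrier M" for u w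
    using that(1)
  proof (induction u)
    case Nil
    show ?case using refl cl[OF that(2)] by simp
  next
    case (Cons x u)
    have c: "\<theta> x \<in> carrier M" "?e u \<in> carrier M" "?e w \<in> carrier M"
      using that(2) Cons.prems by (auto intro!: cl)
    have "(\<theta> x \<otimes>\<^bsub>M\<^esub> (?e u \<otimes>\<^bsub>M\<^esub> ?e w), \<theta> x \<otimes>\<^bsub>M\<^esub> ?e w) \<in> r"
      using Cons by (intro mult refl c) auto
    thus ?case using absorb_letter[of x w] that(2) Cons.prems c trans by (auto simp: m_assoc)
  qed
  have w: "\<theta> ` set w \<subseteq> carrier M" using assms by simp
  have "(?e v, ?e w \<otimes>\<^bsub>M\<^esub> ?e v) \<in> r" using absorb[of w v] assms(2,3) by (auto intro: sym)
  moreover have "(?e w \<otimes>\<^bsub>M\<^esub> ?e v, ?e v \<otimes>\<^bsub>M\<^esub> ?e w) \<in> r" using comm cl assms(2) w by blast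
  moreover have "(?e v \<otimes>\<^bsub>M\<^esub> ?e w, ?e w) \<in> r" using absorb[of v w] assms(3) w by auto
  ultimately show "(?e v, ?e w) \<in> r" using trans by blast
qed

section \<open>Fully invariant congruences on free objects\<close>

text \<open>The homomorphism sending \<open>y\<close> to 1 and all other generators to 0 reads off
  the number of occurrences of \<open>y\<close>, truncated at \<open>k\<close>.\<close>

lemma hom_kernel_truncated_addition_count:
  fixes F :: "'f monoid"
  assumes "free_object E X F" "truncated_addition k \<in> variety E" "k \<ge> 1"
    and "set v \<subseteq> X" "set w \<subseteq> X" "y \<in> X"
    and "(eval_word F (\<lambda>x. x) v, eval_word F (\<lambda>x. x) w) \<in> hom_kernel F (truncated_addition k)"
  shows "min k (count_list v y) = min k (count_list w y)"
proof -
  have "1 \<in> carrier (truncated_addition k)" using assms(3) by simp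
  then obtain h where h: "h \<in> monoid_hom F (truncated_addition k)" "h y = 1"
    "\<forall>ws. set ws \<subseteq> X \<longrightarrow> h (eval_word F (\<lambda>x. x) ws) = 1 [^]\<^bsub>truncated_addition k\<^esub> count_list ws y"
    by (rule free_object_count_hom[OF assms(1,2) inj_replicate_singleton assms(6)])
  have "h (eval_word F (\<lambda>x. x) v) = h (eval_word F (\<lambda>x. x) w)"
    using assms(7) h(1) by (auto simp: hom_kernel_def)
  thus ?thesis using assms(4,5) h(3) by (simp add: truncated_addition_pow)
qed

text \<open>For \<open>k \<ge> 1\<close>, truncation still separates zero from positive counts, so
  words with related values have the same content.\<close>

lemma hom_kernel_truncated_addition_le:
  fixes F :: "'f monoid"
  assumes "free_object E X F" "truncated_addition k \<in> variety E" "k \<ge> 1"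
  shows "hom_kernel F (truncated_addition k) \<subseteq> least_semilattice_congruence F"
proof clarify
  fix a b assume ab: "(a, b) \<in> hom_kernel F (truncated_addition k)"
  hence "a \<in> carrier F" "b \<in> carrier F" by (auto simp: hom_kernel_def)
  then obtain v w where v: "set v \<subseteq> X" "a = eval_word F (\<lambda>x. x) v"
    and w: "set w \<subseteq> X" "b = eval_word F (\<lambda>x. x) w"
    using free_object_generated[OF assms(1)] by metis
  have "y \<in> set v \<longleftrightarrow> y \<in> set w" if "y \<in> X" for y
  proof -
    have "min k (count_list v y) = min k (count_list w y)"
      using hom_kernel_truncated_addition_count[OF assms v(1) w(1) that] ab v(2) w(2) by simp
    hence "count_list v y = 0 \<longleftrightarrow> count_list w y = 0" using assms(3) by (auto simp: min_def split: if_splits)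
    thus ?thesis by (simp add: count_list_0_iff)
  qed
  hence "set v = set w" using v(1) w(1) by blast
  thus "(a, b) \<in> least_semilattice_congruence F"
    using same_content_least_semilattice_congruence[OF free_object_monoid[OF assms(1)], of "\<lambda>x. x"]
      v w free_object_generators[OF assms(1)] by auto
qed

text \<open>For \<open>k \<ge> 2\<close>, the counts 0 and 1 survive truncation unmerged with
  anything else. A word for \<open>a\<close> must therefore contain \<open>y\<close> exactly once
  and no other letter.\<close>

lemma generator_hom_kernel_singleton:
  fixes F :: "'f monoid"
  assumes "free_object E X F" "truncated_addition k \<in> variety E" "k \<ge> 2" "y \<in> X"
    and "(y, a) \<in> hom_kernel F (truncated_addition k)"
  shows "a = y"
proof -
  have "a \<in> carrier F" "y \<in> carrier F" using assms(5) by (auto simp: hom_kernel_def)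
  then obtain w where w: "set w \<subseteq> X" "a = eval_word F (\<lambda>x. x) w"
    using free_object_generated[OF assms(1)] by metis
  interpret monoid F using free_object_monoid[OF assms(1)] .
  have "count_list w x = count_list [y] x" for x
  proof (cases "x \<in> X")
    case True
    have "min k (count_list [y] x) = min k (count_list w x)"
      using assms(3-5) w True \<open>y \<in> carrier F\<close>
      by (intro hom_kernel_truncated_addition_count[OF assms(1,2)]) auto
    thus ?thesis using assms(3) by (auto simp: min_def split: if_splits)
  next
    case False
    thus ?thesis using w(1) assms(4) by (auto simp: count_list_0_iff)
  qed
  hence count: "\<And>x. count_list w x = count_list [y] x" by blast
  have sub: "set w \<subseteq> {y}"
    using count by (metis count_list_0_iff list.set(1) list.simps(15) subsetI)
  have "length w = count_list w y"
    using sub by (induction w) auto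
  hence "length w = 1" using count[of y] by simp
  with sub have "w = [y]" by (cases w) auto
  thus ?thesis using w(2) \<open>y \<in> carrier F\<close> by simp
qed

text \<open>A pair outside the least semilattice congruence is given by two words with different
  contents. Erasing all letters except one that occurs in only one of the words leaves a positive
  power of that letter related to the identity element.\<close>

lemma generator_power_related_to_one:
  fixes F :: "'f monoid"
  assumes "free_object E X F" "congruence F \<alpha>" "fully_invariant F \<alpha>"
    and "\<not> \<alpha> \<subseteq> least_semilattice_congruence F"
  obtains y n where "y \<in> X" "n > 0" "(y [^]\<^bsub>F\<^esub> (n::nat), \<one>\<^bsub>F\<^esub>) \<in> \<alpha>"
proof -
  interpret monoid F using free_object_monoid[OF assms(1)] .
  note X = free_object_generators[OF assms(1)]
  let ?e = "eval_word F (\<lambda>x. x)"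
  obtain a b where ab: "(a, b) \<in> \<alpha>" "(a, b) \<notin> least_semilattice_congruence F"
    using assms(4) by auto
  hence "a \<in> carrier F" "b \<in> carrier F" using congruence_carrier[OF assms(2)] by auto
  then obtain v w where vw: "set v \<subseteq> X" "a = ?e v" "set w \<subseteq> X" "b = ?e w"
    using free_object_generated[OF assms(1)] by metis
  hence "set v \<noteq> set w"
    using ab(2) X same_content_least_semilattice_congruence[OF monoid_axioms, of "\<lambda>x. x" v w] by auto
  \<comment> \<open>Symmetry of \<alpha> allows the word containing the distinguishing letter to be
    put first.\<close>
  then obtain v' w' y where w': "set v' \<subseteq> X" "set w' \<subseteq> X" "(?e v', ?e w') \<in> \<alpha>"
    "y \<in> set v'" "y \<notin> set w'"
    using ab(1) vw congruence_sym[OF assms(2)] by blast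
  have y: "y \<in> X" "y \<in> carrier F" using w' X by auto
  have inj: "inj_on (\<lambda>b::'f. {[b]}) (carrier F)" by (auto simp: inj_on_def)
  obtain h where h: "h \<in> monoid_hom F F" "h y = y"
    "\<forall>ws. set ws \<subseteq> X \<longrightarrow> h (?e ws) = y [^]\<^bsub>F\<^esub> count_list ws y"
    by (rule free_object_count_hom[OF assms(1) free_object_in_variety[OF assms(1)] inj y])
  have "(y [^]\<^bsub>F\<^esub> count_list v' y, y [^]\<^bsub>F\<^esub> count_list w' y) \<in> \<alpha>"
    using fully_invariantD[OF assms(3) h(1) w'(3)] w'(1,2) h(3) by simp
  moreover have "count_list v' y > 0" "count_list w' y = 0"
    using w'(4,5) by (simp_all add: count_list_0_iff flip: neq0_conv)
  ultimately show ?thesis using that[OF y(1)] by simp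
qed

text \<open>By freeness some endomorphism carries \<open>y\<close> to any given element, and every
  endomorphism fixes the identity element.\<close>

lemma universal_if_generator_related_to_one:
  fixes F :: "'f monoid"
  assumes "free_object E X F" "congruence F \<alpha>" "fully_invariant F \<alpha>" "y \<in> X" "(y, \<one>\<^bsub>F\<^esub>) \<in> \<alpha>"
  shows "\<alpha> = carrier F \<times> carrier F"
proof -
  have inj: "inj_on (\<lambda>b::'f. {[b]}) (carrier F)" by (auto simp: inj_on_def)
  have "(a, \<one>\<^bsub>F\<^esub>) \<in> \<alpha>" if a: "a \<in> carrier F" for a
  proof -
    obtain h where h: "h \<in> monoid_hom F F" "h y = a"
      by (rule free_object_count_hom[OF assms(1) free_object_in_variety[OF assms(1)] inj assms(4) a])
    show ?thesis
      using fully_invariantD[OF assms(3) h(1) assms(5)] h(2) monoid_hom_one[OF h(1)] by simp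
  qed
  thus ?thesis
    using congruence_carrier[OF assms(2)] congruence_sym[OF assms(2)] congruence_trans[OF assms(2)]
    by blast
qed

lemma fully_invariant_congruence_universal:
  fixes F :: "'f monoid"
  assumes ncr: "\<not> completely_regular_variety TYPE('m) E"
    and almost: "almost_fi_permutable TYPE('f) E"
    and F: "free_object E X F" and \<alpha>: "congruence F \<alpha>" "fully_invariant F \<alpha>"
    and not_le: "\<not> \<alpha> \<subseteq> least_semilattice_congruence F"
  shows "\<alpha> = carrier F \<times> carrier F"
proof -
  interpret monoid F using free_object_monoid[OF F] .
  obtain y n where y: "y \<in> X" "n > 0" "(y [^]\<^bsub>F\<^esub> (n::nat), \<one>\<^bsub>F\<^esub>) \<in> \<alpha>"
    using generator_power_related_to_one[OF F \<alpha> not_le] by metis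
  have y': "y \<in> carrier F" using y(1) free_object_generators[OF F] by auto
  note T = truncated_addition_in_variety[OF ncr]
  \<comment> \<open>Truncation at 1 records exactly the content of a word, so the intersection keeps
    the part of \<alpha> inside the least semilattice congruence.\<close>
  define \<beta> where "\<beta> = \<alpha> \<inter> hom_kernel F (truncated_addition 1)"
  define \<gamma> where "\<gamma> = hom_kernel F (truncated_addition 2)"
  have "congruence F \<beta>" "fully_invariant F \<beta>" "\<beta> \<subseteq> least_semilattice_congruence F"
    using hom_kernel_truncated_addition_le[OF F T, of 1] unfolding \<beta>_def
    by (auto intro: congruence_Int fully_invariant_Int \<alpha> congruence_hom_kernel
        fully_invariant_hom_kernel monoid_axioms)
  moreover have "congruence F \<gamma>" "fully_invariant F \<gamma>" "\<gamma> \<subseteq> least_semilattice_congruence F"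
    unfolding \<gamma>_def
    by (simp_all add: congruence_hom_kernel fully_invariant_hom_kernel monoid_axioms
        hom_kernel_truncated_addition_le[OF F T])
  ultimately have perm: "\<beta> O \<gamma> = \<gamma> O \<beta>"
    using almost F unfolding almost_fi_permutable_def permute_def by blast
  have hom_pow: "h (y [^]\<^bsub>F\<^esub> m) = min k (m * h y)" "h y \<le> k"
    if "h \<in> monoid_hom F (truncated_addition k)" for h k and m :: nat
    using monoid_hom_pow[OF monoid_axioms that y'] monoid_hom_closed[OF that y']
    by (simp_all add: truncated_addition_pow)
  have "(y [^]\<^bsub>F\<^esub> n \<otimes>\<^bsub>F\<^esub> y, \<one>\<^bsub>F\<^esub> \<otimes>\<^bsub>F\<^esub> y) \<in> \<alpha>"
    using congruence_mult[OF \<alpha>(1) y(3) congruence_refl[OF \<alpha>(1) y']] .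
  hence "(y, y [^]\<^bsub>F\<^esub> Suc n) \<in> \<alpha>"
    using y' congruence_sym[OF \<alpha>(1)] by simp
  moreover have "(y, y [^]\<^bsub>F\<^esub> Suc n) \<in> hom_kernel F (truncated_addition 1)"
  proof -
    have "h y = h (y [^]\<^bsub>F\<^esub> Suc n)" if "h \<in> monoid_hom F (truncated_addition 1)" for h
      using hom_pow(1)[OF that, of "Suc n"] hom_pow(2)[OF that]
      by (cases "h y = 0") (simp_all del: nat_pow_Suc)
    thus ?thesis using y' unfolding hom_kernel_def by blast
  qed
  ultimately have "(y, y [^]\<^bsub>F\<^esub> Suc n) \<in> \<beta>" by (simp add: \<beta>_def)
  moreover have "(y [^]\<^bsub>F\<^esub> Suc n, y [^]\<^bsub>F\<^esub> (2::nat)) \<in> \<gamma>"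
  proof -
    have "h (y [^]\<^bsub>F\<^esub> Suc n) = h (y [^]\<^bsub>F\<^esub> (2::nat))" if "h \<in> monoid_hom F (truncated_addition 2)" for h
    proof (cases "h y = 0")
      case False
      \<comment> \<open>Since \<open>n > 0\<close>, both exponents are at least 2, so every
        homomorphism that does not kill \<open>y\<close> sends both powers to the zero element
        2.\<close>
      hence "Suc n * h y \<ge> 2 * 1" "2 * h y \<ge> 2 * 1"
        using y(2) by (intro mult_le_mono; simp)+
      thus ?thesis using hom_pow(1)[OF that] by (metis min.absorb1 mult.right_neutral)
    qed (simp only: hom_pow(1)[OF that] mult_0_right)
    thus ?thesis using y' unfolding \<gamma>_def hom_kernel_def by blast
  qed
  ultimately have "(y, y [^]\<^bsub>F\<^esub> (2::nat)) \<in> \<gamma> O \<beta>" using perm by blast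
  then obtain a where a: "(y, a) \<in> \<gamma>" "(a, y [^]\<^bsub>F\<^esub> (2::nat)) \<in> \<beta>" by blast
  have "a = y"
    using generator_hom_kernel_singleton[OF F T _ y(1)] a(1) unfolding \<gamma>_def by blast
  with a(2) have "(y, y \<otimes>\<^bsub>F\<^esub> y) \<in> \<alpha>"
    using y' by (simp add: \<beta>_def numeral_2_eq_2)
  moreover obtain m where m: "n = Suc m" using y(2) by (cases n) auto
  \<comment> \<open>Multiplying by the power with exponent \<open>n - 1\<close> raises the pair to
    exponents \<open>n\<close> and \<open>n + 1\<close>, which are already tied to the identity
    element and to \<open>y\<close> respectively.\<close>
  ultimately have "(y [^]\<^bsub>F\<^esub> m \<otimes>\<^bsub>F\<^esub> y, y [^]\<^bsub>F\<^esub> m \<otimes>\<^bsub>F\<^esub> (y \<otimes>\<^bsub>F\<^esub> y)) \<in> \<alpha>"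
    using y' by (intro congruence_mult[OF \<alpha>(1)] congruence_refl[OF \<alpha>(1)]) auto
  hence "(y [^]\<^bsub>F\<^esub> n, y [^]\<^bsub>F\<^esub> Suc n) \<in> \<alpha>"
    using y' m by (simp add: m_assoc)
  hence "(y, \<one>\<^bsub>F\<^esub>) \<in> \<alpha>"
    using y(3) \<open>(y, y [^]\<^bsub>F\<^esub> Suc n) \<in> \<alpha>\<close> congruence_sym[OF \<alpha>(1)] congruence_trans[OF \<alpha>(1)] by metis
  thus ?thesis using universal_if_generator_related_to_one[OF F \<alpha> y(1)] by blast
qed

theorem corollary1p6:
  fixes E :: "identity set"
  assumes "\<not> completely_regular_variety TYPE('m) E"
    and "almost_fi_permutable TYPE('f) E"
  shows "fi_permutable TYPE('f) E"
  unfolding fi_permutable_def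
proof (intro allI impI)
  fix F :: "'f monoid" and X \<alpha> \<beta>
  assume F: "free_object E X F"
    and \<alpha>: "congruence F \<alpha> \<and> fully_invariant F \<alpha>" and \<beta>: "congruence F \<beta> \<and> fully_invariant F \<beta>"
  note universal = fully_invariant_congruence_universal[OF assms F]
  show "permute \<alpha> \<beta>"
  proof (cases "\<alpha> \<subseteq> least_semilattice_congruence F \<and> \<beta> \<subseteq> least_semilattice_congruence F")
    case True
    with assms(2) F \<alpha> \<beta> show ?thesis unfolding almost_fi_permutable_def by blast
  next
    case False
    \<comment> \<open>At least one of the two congruences is now universal.\<close>
    with universal \<alpha> \<beta> permute_universal show ?thesis by metis
  qed
qed

end
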